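(* Consider the velocity controller $K_{\mathrm v}$ given by $$\dot x_{\mathrm{v,k}}=A_{\mathrm k}(p)x_{\mathrm{v,k}}+B_{\mathrm k}(p)u_{\mathrm{v,k}},\qquad y_{\mathrm{v,k}}=C_{\mathrm k}(p)x_{\mathrm{v,k}}+D_{\mathrm k}(p)u_{\mathrm{v,k}},$$ and the nonlinear time-invariant controller $K$ given by $$\dot{\breve x}_{\mathrm k}=\breve A_{\mathrm k}(p)\breve x_{\mathrm k}+\breve B_{\mathrm k}(p,\dot p)u_{\mathrm k},\qquad y_{\mathrm k}=\breve C_{\mathrm k}\breve x_{\mathrm k}+\breve D_{\mathrm k}(p)u_{\mathrm k},$$ with state $\breve x_{\mathrm k}(t)\in\mathbb R^{n_{x_k}+n_{y_k}}$, where $$\breve A_{\mathrm k}(p)=\begin{bmatrix}A_{\mathrm k}(p)&0\\C_{\mathrm k}(p)&0\end{bmatrix},\quad \breve B_{\mathrm k}(p,\dot p)=\begin{bmatrix}A_{\mathrm k}(p)B_{\mathrm k}(p)-\partial B_{\mathrm k}(p,\dot p)\\C_{\mathrm k}(p)B_{\mathrm k}(p)-\partial D_{\mathrm k}(p,\dot p)\end{bmatrix},\quad \breve C_{\mathrm k}=\begin{bmatrix}0&I\end{bmatrix},\quad \breve D_{\mathrm k}(p)=D_{\mathrm k}(p),$$ with $p=\eta(x,u)$, $\partial B_{\mathrm k}(p,\dot p)=\sum_{i=1}^{n_p}\frac{\partial B_{\mathrm k}(p)}{\partial p_i}\dot p_i$ and $\partial D_{\mathrm k}(p,\dot p)=\sum_{i=1}^{n_p}\frac{\partial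 D_{\mathrm k}(p)}{\partial p_i}\dot p_i$. Then $K$ is the primal form of $K_{\mathrm v}$, and the velocity form of $K$ is $K_{\mathrm v}$.
   Context: In $K_{\mathrm v}$, $x_{\mathrm{v,k}}(t)\in\mathbb R^{n_{x_k}}$ is the state, $u_{\mathrm{v,k}}(t)\in\mathbb R^{n_{u_k}}$ the input, $y_{\mathrm{v,k}}(t)\in\mathbb R^{n_{y_k}}$ the output, and $A_{\mathrm k},\dots,D_{\mathrm k}$ are matrix functions of the scheduling-variable $p(t)\in\mathcal P\subset\mathbb R^{n_p}$ belonging to a given class (e.g. affine or rational), with $B_{\mathrm k},D_{\mathrm k}$ continuously differentiable; $p_i$ is the $i$-th component of $p$. The scheduling-variable is $p(t)=\eta(x(t),u(t))$, where $x,u$ are the state and control input of a controlled plant, $\eta$ is continuously differentiable and $x,u$ are continuously differentiable, so that $p$ is a continuously differentiable function of time. "$K$ is the primal form of $K_{\mathrm v}$" means that $K$ is obtained from $K_{\mathrm v}$ by time-differentiating the input and time-integrating the output: for every continuously differentiable $u_{\mathrm k},y_{\mathrm k}$ such that, with $u_{\mathrm{v,k}}=\dot u_{\mathrm k}$ and $y_{\mathrm{v,k}}=\dot y_{\mathrm k}$, there is a state trajectory $x_{\mathrm{v,k}}$ satisfying the equations of $K_{\mathrm v}$, there is a state trajectory $\breve x_{\mathrm k}$ such that $(\breve x_{\mathrm k},u_{\mathrm k},y_{\mathrm k})$ satisfies the equations of $K$. "The velocity form of $K$ is $K_{\mathrm v}$" means conversely that $K$, with its input time-integrated and its output time-differentiated,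 is $K_{\mathrm v}$: for every solution $(\breve x_{\mathrm k},u_{\mathrm k},y_{\mathrm k})$ of $K$ with $u_{\mathrm k},y_{\mathrm k}$ continuously differentiable, there is a state trajectory $x_{\mathrm{v,k}}$ such that $(x_{\mathrm{v,k}},u_{\mathrm{v,k}},y_{\mathrm{v,k}})$ with $u_{\mathrm{v,k}}=\dot u_{\mathrm k}$, $y_{\mathrm{v,k}}=\dot y_{\mathrm k}$ satisfies the equations of $K_{\mathrm v}$. *)

theory Defs
  imports "HOL-Analysis.Analysis"
begin

text \<open>The derivative is taken relative to \<open>S\<close>: two-sided in the interior of a time
  interval and one-sided at an endpoint belonging to it.\<close>
definition C1_on :: "'a::real_normed_vector set \<Rightarrow> ('a \<Rightarrow> 'b::real_normed_vector) \<Rightarrow> bool" where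
  "C1_on S f \<longleftrightarrow>
     (\<exists>f' :: 'a \<Rightarrow> 'a \<Rightarrow>\<^sub>L 'b.
        (\<forall>x\<in>S. (f has_derivative blinfun_apply (f' x)) (at x within S)) \<and> continuous_on S f')"

definition time_deriv :: "real set \<Rightarrow> (real \<Rightarrow> 'a::real_normed_vector) \<Rightarrow> real \<Rightarrow> 'a" where
  "time_deriv T f t = vector_derivative f (at t within T)"

definition partial_deriv :: "'p::finite \<Rightarrow> (real^'p \<Rightarrow> 'b::real_normed_vector) \<Rightarrow> real^'p \<Rightarrow> 'b" where
  "partial_deriv i f p = vector_derivative (\<lambda>s. f (p + s *\<^sub>R axis i 1)) (at 0)"

text \<open>\<open>directional f p q\<close> is the sum over \<open>i\<close> of the \<open>i\<close>-th partial derivative of \<open>f\<close> at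
  \<open>p\<close> times the \<open>i\<close>-th component of \<open>q\<close>; here \<open>q\<close> stands for the time derivative of \<open>p\<close>.\<close>
definition directional :: "(real^'p::finite \<Rightarrow> 'b::real_normed_vector) \<Rightarrow> real^'p \<Rightarrow> real^'p \<Rightarrow> 'b" where
  "directional f p q = (\<Sum>i\<in>UNIV. (q $ i) *\<^sub>R partial_deriv i f p)"

text \<open>A matrix is the vector of its rows, so \<open>vcat\<close> stacks both vectors and matrices.\<close>
definition vcat :: "'a^'m::finite \<Rightarrow> 'a^'n::finite \<Rightarrow> 'a^('m + 'n)" where
  "vcat a b = (\<chi> i. case i of Inl j \<Rightarrow> a $ j | Inr j \<Rightarrow> b $ j)"

definition hcat :: "'a^'m::finite^'k::finite \<Rightarrow> 'a^'n::finite^'k \<Rightarrow> 'a^('m + 'n)^'k" where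
  "hcat M N = (\<chi> i. vcat (M $ i) (N $ i))"

definition state_space_solution ::
  "real set \<Rightarrow> (real \<Rightarrow> real^'x::finite^'x) \<Rightarrow> (real \<Rightarrow> real^'u::finite^'x)
    \<Rightarrow> (real \<Rightarrow> real^'x^'y::finite) \<Rightarrow> (real \<Rightarrow> real^'u^'y)
    \<Rightarrow> (real \<Rightarrow> real^'x) \<Rightarrow> (real \<Rightarrow> real^'u) \<Rightarrow> (real \<Rightarrow> real^'y) \<Rightarrow> bool" where
  "state_space_solution T A B C D x u y \<longleftrightarrow>
     (\<forall>t\<in>T. (x has_vector_derivative A t *v x t + B t *v u t) (at t within T)
           \<and> y t = C t *v x t + D t *v u t)"

text \<open>A controller is represented by its solutions: a relation between the scheduling
  signal, the state, the input and the output.\<close>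
type_synonym ('p, 'x, 'u, 'y) controller =
  "(real \<Rightarrow> real^'p) \<Rightarrow> (real \<Rightarrow> real^'x) \<Rightarrow> (real \<Rightarrow> real^'u) \<Rightarrow> (real \<Rightarrow> real^'y) \<Rightarrow> bool"

definition velocity_controller ::
  "real set \<Rightarrow> (real^'p::finite \<Rightarrow> real^'x::finite^'x) \<Rightarrow> (real^'p \<Rightarrow> real^'u::finite^'x)
    \<Rightarrow> (real^'p \<Rightarrow> real^'x^'y::finite) \<Rightarrow> (real^'p \<Rightarrow> real^'u^'y)
    \<Rightarrow> ('p, 'x, 'u, 'y) controller" where
  "velocity_controller T A B C D p =
     state_space_solution T (\<lambda>t. A (p t)) (\<lambda>t. B (p t)) (\<lambda>t. C (p t)) (\<lambda>t. D (p t))"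

definition A_breve ::
  "(real^'p::finite \<Rightarrow> real^'x::finite^'x) \<Rightarrow> (real^'p \<Rightarrow> real^'x^'y::finite)
    \<Rightarrow> real^'p \<Rightarrow> real^('x + 'y)^('x + 'y)" where
  "A_breve A C p = vcat (hcat (A p) 0) (hcat (C p) 0)"

definition B_breve ::
  "(real^'p::finite \<Rightarrow> real^'x::finite^'x) \<Rightarrow> (real^'p \<Rightarrow> real^'u::finite^'x)
    \<Rightarrow> (real^'p \<Rightarrow> real^'x^'y::finite) \<Rightarrow> (real^'p \<Rightarrow> real^'u^'y)
    \<Rightarrow> real^'p \<Rightarrow> real^'p \<Rightarrow> real^'u^('x + 'y)" where
  "B_breve A B C D p q =
     vcat (A p ** B p - directional B p q) (C p ** B p - directional D p q)"

definition C_breve :: "real^('x::finite + 'y::finite)^'y" where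
  "C_breve = hcat 0 (mat 1)"

definition D_breve :: "(real^'p::finite \<Rightarrow> real^'u::finite^'y::finite) \<Rightarrow> real^'p \<Rightarrow> real^'u^'y" where
  "D_breve D p = D p"

definition primal_controller ::
  "real set \<Rightarrow> (real^'p::finite \<Rightarrow> real^'x::finite^'x) \<Rightarrow> (real^'p \<Rightarrow> real^'u::finite^'x)
    \<Rightarrow> (real^'p \<Rightarrow> real^'x^'y::finite) \<Rightarrow> (real^'p \<Rightarrow> real^'u^'y)
    \<Rightarrow> ('p, 'x + 'y, 'u, 'y) controller" where
  "primal_controller T A B C D p =
     state_space_solution T (\<lambda>t. A_breve A C (p t))
       (\<lambda>t. B_breve A B C D (p t) (time_deriv T p t)) (\<lambda>t. C_breve) (\<lambda>t. D_breve D (p t))"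

definition scheduling_signals ::
  "real set \<Rightarrow> ((real^'n::finite) \<times> (real^'m::finite) \<Rightarrow> real^'p::finite) \<Rightarrow> (real^'p) set
    \<Rightarrow> (real \<Rightarrow> real^'p) set" where
  "scheduling_signals T \<eta> P =
     {(\<lambda>t. \<eta> (x t, u t)) | x u. C1_on T x \<and> C1_on T u \<and> (\<forall>t\<in>T. \<eta> (x t, u t) \<in> P)}"

definition is_primal_form ::
  "real set \<Rightarrow> (real \<Rightarrow> real^'p::finite) set \<Rightarrow> ('p, 'x::finite, 'u::finite, 'y::finite) controller
    \<Rightarrow> ('p, 'v::finite, 'u, 'y) controller \<Rightarrow> bool" where
  "is_primal_form T S K Kv \<longleftrightarrow>
     (\<forall>p\<in>S. \<forall>u y. C1_on T u \<and> C1_on T y \<and> (\<exists>xv. Kv p xv (time_deriv T u) (time_deriv T y))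
        \<longrightarrow> (\<exists>x. K p x u y))"

definition is_velocity_form ::
  "real set \<Rightarrow> (real \<Rightarrow> real^'p::finite) set \<Rightarrow> ('p, 'v::finite, 'u::finite, 'y::finite) controller
    \<Rightarrow> ('p, 'x::finite, 'u, 'y) controller \<Rightarrow> bool" where
  "is_velocity_form T S Kv K \<longleftrightarrow>
     (\<forall>p\<in>S. \<forall>x u y. C1_on T u \<and> C1_on T y \<and> K p x u y
        \<longrightarrow> (\<exists>xv. Kv p xv (time_deriv T u) (time_deriv T y)))"

end

theory Submission
  imports Defs
begin

text \<open>The state transformation \<open>x\<^sub>1 = x\<^sub>v - B(p) u\<close>, \<open>x\<^sub>2 = y - D(p) u\<close> carries solutions of
  the velocity controller, driven by the derivatives of \<open>u\<close> and \<open>y\<close>, to solutions of the primal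
  controller, and \<open>x\<^sub>v = x\<^sub>1 + B(p) u\<close> carries them back: in the product rule for \<open>B(p) u\<close> and
  \<open>D(p) u\<close> the terms containing the derivative of \<open>u\<close> cancel against the input terms of the
  velocity controller, and the chain rule identifies the derivatives of \<open>B(p)\<close> and \<open>D(p)\<close> with
  the correction terms in the primal input matrix.\<close>

text \<open>In finite dimension bilinearity already gives boundedness; this makes the product rule
  for a matrix times a vector available.\<close>

lemma bounded_bilinear_matrix_vector_mult:
  "bounded_bilinear ((*v) :: real^'n::finite^'m::finite \<Rightarrow> real^'n \<Rightarrow> real^'m)"
proof -
  have "bilinear ((*v) :: real^'n^'m \<Rightarrow> real^'n \<Rightarrow> real^'m)"
    by (auto simp: bilinear_def matrix_vector_mult_add_rdistrib scaleR_matrix_vector_assoc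
        intro!: linearI matrix_vector_mul_linear)
  then show ?thesis by (simp add: bilinear_conv_bounded_bilinear)
qed

lemmas has_vector_derivative_matrix_vector_mult =
  bounded_bilinear.has_vector_derivative [OF bounded_bilinear_matrix_vector_mult]

lemma vcat_nth [simp]: "vcat a b $ Inl i = a $ i" "vcat a b $ Inr j = b $ j"
  by (simp_all add: vcat_def)

lemma vcat_surj: obtains a b where "x = vcat a b"
proof
  show "x = vcat (\<chi> i. x $ Inl i) (\<chi> j. x $ Inr j)"
    by (auto simp: vec_eq_iff vcat_def split: sum.splits)
qed

lemma vcat_add: "vcat a b + vcat c d = vcat (a + c) (b + d)"
  by (auto simp: vec_eq_iff vcat_def split: sum.splits)

lemma vcat_matrix_vector_mult: "vcat M N *v x = vcat (M *v x) (N *v x)"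
  by (auto simp: vec_eq_iff vcat_def matrix_vector_mult_def split: sum.splits)

lemma hcat_vcat_matrix_vector_mult: "hcat M N *v vcat a b = M *v a + N *v b"
  by (simp add: vec_eq_iff hcat_def matrix_vector_mult_def UNIV_Plus_UNIV [symmetric]
      sum.Plus del: UNIV_Plus_UNIV)

lemma has_vector_derivative_vcat_iff:
  fixes a :: "real \<Rightarrow> real^'m::finite" and b :: "real \<Rightarrow> real^'n::finite"
  shows "((\<lambda>t. vcat (a t) (b t)) has_vector_derivative vcat a' b') (at t within T) \<longleftrightarrow>
     (a has_vector_derivative a') (at t within T) \<and> (b has_vector_derivative b') (at t within T)"
proof -
  have vec: "(f has_vector_derivative f') (at t within T) \<longleftrightarrow>
      (\<forall>i. ((\<lambda>t. f t $ i) has_vector_derivative f' $ i) (at t within T))"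
    for f :: "real \<Rightarrow> real^'k::finite" and f'
    unfolding has_vector_derivative_def
      has_derivative_componentwise_within [where f = f and 'b = "real^'k"]
    by (simp add: Basis_vec_def inner_axis)
  show ?thesis
    unfolding vec [of "\<lambda>t. vcat (a t) (b t)"] vec [of a] vec [of b]
    by (simp add: split_sum_all)
qed

lemma C1_on_has_derivative:
  assumes "C1_on S f" and "x \<in> S"
  obtains f' where "(f has_derivative f') (at x within S)"
  using assms unfolding C1_on_def by blast

lemma C1_on_has_time_deriv:
  assumes "C1_on T f" and "t \<in> T"
  shows "(f has_vector_derivative time_deriv T f t) (at t within T)"
  using assms unfolding time_deriv_def vector_derivative_works [symmetric]
  by (meson C1_on_has_derivative differentiable_def)

text \<open>By the chain rule along the line through \<open>p\<close> in direction
  \<open>axis i 1\<close>, each partial derivative is \<open>f'\<close> at a basis vector; linearity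
  of \<open>f'\<close> then sums them to \<open>f' q\<close>.\<close>

lemma directional_eq_derivative:
  assumes "(f has_derivative f') (at p)"
  shows "directional f p q = f' q"
proof -
  interpret linear f'
    using assms by (rule has_derivative_linear)
  have "partial_deriv i f p = f' (axis i 1)" for i
  proof -
    have "((\<lambda>s. p + s *\<^sub>R axis i 1) has_vector_derivative axis i 1) (at 0)"
      by (auto intro!: derivative_eq_intros simp: has_vector_derivative_def)
    then have "((f \<circ> (\<lambda>s. p + s *\<^sub>R axis i 1)) has_vector_derivative f' (axis i 1)) (at 0)"
      using assms by (intro vector_derivative_diff_chain_within) (auto intro: has_derivative_at_withinI)
    then show ?thesis
      unfolding partial_deriv_def o_def by (rule vector_derivative_at)
  qed
  then have "directional f p q = f' (\<Sum>i\<in>UNIV. (q $ i) *\<^sub>R axis i 1)"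
    by (simp add: directional_def sum scale)
  also have "(\<Sum>i\<in>UNIV. (q $ i) *\<^sub>R axis i 1) = q"
    using basis_expansion [of q] by (simp add: scalar_mult_eq_scaleR)
  finally show ?thesis .
qed

text \<open>Openness of \<open>U\<close> turns the derivative relative to \<open>U\<close> into a
  full derivative at \<open>p t\<close>, as the two-sided partial derivatives require. The time
  derivative of \<open>p\<close> may still be one-sided.\<close>

lemma C1_on_compose_has_vector_derivative:
  assumes "C1_on U f" and "open U" and "p t \<in> U"
    and p: "(p has_vector_derivative p') (at t within T)"
  shows "((\<lambda>t. f (p t)) has_vector_derivative directional f (p t) p') (at t within T)"
proof -
  obtain f' where f': "(f has_derivative f') (at (p t))"
    using assms by (metis C1_on_has_derivative at_within_open)
  have "((f \<circ> p) has_vector_derivative f' p') (at t within T)"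
    using p has_derivative_at_withinI [OF f'] by (rule vector_derivative_diff_chain_within)
  then show ?thesis
    by (simp add: directional_eq_derivative [OF f'] o_def)
qed

text \<open>The operator \<open>vector_derivative\<close> is a choice, so existence has to be shown
  first; it follows from the chain rule for \<eta> applied to the pair of plant state and
  input.\<close>

lemma scheduling_signal_has_time_deriv:
  assumes "C1_on UNIV \<eta>" and "p \<in> scheduling_signals T \<eta> P" and "t \<in> T"
  shows "(p has_vector_derivative time_deriv T p t) (at t within T)"
proof -
  obtain x u where p: "p = (\<lambda>t. \<eta> (x t, u t))" and "C1_on T x" and "C1_on T u"
    using assms(2) by (auto simp: scheduling_signals_def)
  obtain x' u' where
    "(x has_derivative x') (at t within T)" and "(u has_derivative u') (at t within T)"
    using \<open>C1_on T x\<close> \<open>C1_on T u\<close> assms(3) by (meson C1_on_has_derivative)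
  then have "((\<lambda>t. (x t, u t)) has_derivative (\<lambda>h. (x' h, u' h))) (at t within T)"
    by (rule has_derivative_Pair)
  moreover obtain e' where "(\<eta> has_derivative e') (at (x t, u t))"
    using C1_on_has_derivative [OF assms(1) UNIV_I] by blast
  ultimately have "(p has_derivative (\<lambda>h. e' (x' h, u' h))) (at t within T)"
    unfolding p by (rule has_derivative_compose)
  then show ?thesis
    unfolding time_deriv_def vector_derivative_works [symmetric] by (rule differentiableI)
qed

text \<open>A connected set that is not a single point has no isolated points. Hence derivatives
  relative to \<open>T\<close> are unique, even at endpoints.\<close>

lemma at_within_interval_neq_bot:
  fixes T :: "real set"
  assumes "is_interval T" and "interior T \<noteq> {}" and "t \<in> T"
  shows "at t within T \<noteq> bot"
proof -
  have "\<not> (\<exists>a. T = {a})"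
    using assms(2) by auto
  then show ?thesis
    using assms connected_imp_perfect is_interval_connected trivial_limit_within by blast
qed

lemma time_deriv_eqI:
  assumes "is_interval T" and "interior T \<noteq> {}" and "t \<in> T"
    and "(f has_vector_derivative f') (at t within T)"
  shows "time_deriv T f t = f'"
  unfolding time_deriv_def
  using at_within_interval_neq_bot [OF assms(1-3)] assms(4) by (rule vector_derivative_within)

text \<open>The input terms \<open>A (p t) ** B (p t)\<close> and \<open>C (p t) ** B (p t)\<close>
  are absorbed into the state terms, which exposes the velocity state
  \<open>v t + B (p t) *v u t\<close>. The zero blocks keep \<open>w\<close> out of both
  differential equations, and \<open>C_breve\<close> reads off \<open>w\<close>.\<close>

lemma primal_controller_vcat_iff:
  "primal_controller T A B C D p (\<lambda>t. vcat (v t) (w t)) u y \<longleftrightarrow>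
    (\<forall>t\<in>T. (v has_vector_derivative
          A (p t) *v (v t + B (p t) *v u t) - directional B (p t) (time_deriv T p t) *v u t)
          (at t within T)
      \<and> (w has_vector_derivative
          C (p t) *v (v t + B (p t) *v u t) - directional D (p t) (time_deriv T p t) *v u t)
          (at t within T)
      \<and> y t = w t + D (p t) *v u t)"
  by (simp add: primal_controller_def state_space_solution_def A_breve_def B_breve_def
      C_breve_def D_breve_def vcat_matrix_vector_mult hcat_vcat_matrix_vector_mult vcat_add
      has_vector_derivative_vcat_iff matrix_vector_mult_diff_rdistrib matrix_vector_right_distrib
      matrix_vector_mul_assoc add_diff_eq)

theorem theorem11:
  fixes T :: "real set"
    and P U :: "(real^'p::finite) set"
    and \<eta> :: "(real^'n::finite) \<times> (real^'m::finite) \<Rightarrow> real^'p"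
    and A :: "real^'p \<Rightarrow> real^'x::finite^'x"
    and B :: "real^'p \<Rightarrow> real^'u::finite^'x"
    and C :: "real^'p \<Rightarrow> real^'x^'y::finite"
    and D :: "real^'p \<Rightarrow> real^'u^'y"
  assumes "is_interval T" and "interior T \<noteq> {}"
    and "C1_on UNIV \<eta>"
    and "open U" and "P \<subseteq> U"
    and "C1_on U B" and "C1_on U D"
  shows "is_primal_form T (scheduling_signals T \<eta> P)
           (primal_controller T A B C D) (velocity_controller T A B C D)
         \<and> is_velocity_form T (scheduling_signals T \<eta> P)
           (velocity_controller T A B C D) (primal_controller T A B C D)"
proof -
  \<comment> \<open>The row index type of \<open>M\<close> is left free so that the rule serves both
    \<open>B\<close> and \<open>D\<close>.\<close>
  have product: "((\<lambda>t. M (p t) *v u t) has_vector_derivative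
      M (p t) *v time_deriv T u t + directional M (p t) (time_deriv T p t) *v u t) (at t within T)"
    if "p \<in> scheduling_signals T \<eta> P" "C1_on T u" "C1_on U M" "t \<in> T"
    for p u t and M :: "real^'p \<Rightarrow> real^'u^'k::finite"
  proof -
    have "p t \<in> U"
      using that assms(5) by (auto simp: scheduling_signals_def)
    then show ?thesis
      using that assms(3,4)
      by (intro has_vector_derivative_matrix_vector_mult C1_on_compose_has_vector_derivative
          scheduling_signal_has_time_deriv C1_on_has_time_deriv)
  qed
  show ?thesis
  proof
    show "is_primal_form T (scheduling_signals T \<eta> P)
        (primal_controller T A B C D) (velocity_controller T A B C D)"
      unfolding is_primal_form_def
    proof (intro ballI allI impI; elim conjE exE)
      fix p u y xv
      assume p: "p \<in> scheduling_signals T \<eta> P" and u: "C1_on T u" and y: "C1_on T y"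
        and "velocity_controller T A B C D p xv (time_deriv T u) (time_deriv T y)"
      then have xv: "(xv has_vector_derivative
            A (p t) *v xv t + B (p t) *v time_deriv T u t) (at t within T)"
        and y': "time_deriv T y t = C (p t) *v xv t + D (p t) *v time_deriv T u t"
        if "t \<in> T" for t
        using that by (auto simp: velocity_controller_def state_space_solution_def)
      have "primal_controller T A B C D p
          (\<lambda>t. vcat (xv t - B (p t) *v u t) (y t - D (p t) *v u t)) u y"
        unfolding primal_controller_vcat_iff
      proof (intro ballI conjI)
        fix t assume t: "t \<in> T"
        show "((\<lambda>t. xv t - B (p t) *v u t) has_vector_derivative
            A (p t) *v (xv t - B (p t) *v u t + B (p t) *v u t)
              - directional B (p t) (time_deriv T p t) *v u t) (at t within T)"
          using has_vector_derivative_diff [OF xv [OF t] product [OF p u assms(6) t]]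
          by simp
        show "((\<lambda>t. y t - D (p t) *v u t) has_vector_derivative
            C (p t) *v (xv t - B (p t) *v u t + B (p t) *v u t)
              - directional D (p t) (time_deriv T p t) *v u t) (at t within T)"
          \<comment> \<open>The velocity output equation rewrites the derivative of
            \<open>y\<close>, and its feedthrough term cancels the one from the product
            rule.\<close>
          using has_vector_derivative_diff
            [OF C1_on_has_time_deriv [OF y t] product [OF p u assms(7) t]]
          by (simp add: y' [OF t])
      qed simp
      then show "\<exists>x. primal_controller T A B C D p x u y" by blast
    qed
    show "is_velocity_form T (scheduling_signals T \<eta> P)
        (velocity_controller T A B C D) (primal_controller T A B C D)"
      unfolding is_velocity_form_def
    proof (intro ballI allI impI; elim conjE)
      fix p x u y
      assume p: "p \<in> scheduling_signals T \<eta> P" and u: "C1_on T u" and y: "C1_on T y"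
        and K: "primal_controller T A B C D p x u y"
      \<comment> \<open>An arbitrary state trajectory is split pointwise into its two blocks, so
        that the block form of the primal equations applies.\<close>
      have "\<exists>a b. x t = vcat a b" for t
        by (meson vcat_surj)
      then obtain v w where "x = (\<lambda>t. vcat (v t) (w t))"
        by metis
      with K have v: "(v has_vector_derivative A (p t) *v (v t + B (p t) *v u t)
            - directional B (p t) (time_deriv T p t) *v u t) (at t within T)"
        and w: "(w has_vector_derivative C (p t) *v (v t + B (p t) *v u t)
            - directional D (p t) (time_deriv T p t) *v u t) (at t within T)"
        and y: "y t = w t + D (p t) *v u t"
        if "t \<in> T" for t
        using that by (auto simp: primal_controller_vcat_iff)
      have "velocity_controller T A B C D p (\<lambda>t. v t + B (p t) *v u t)
          (time_deriv T u) (time_deriv T y)"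
        unfolding velocity_controller_def state_space_solution_def
      proof (intro ballI conjI)
        fix t assume t: "t \<in> T"
        show "((\<lambda>t. v t + B (p t) *v u t) has_vector_derivative
            A (p t) *v (v t + B (p t) *v u t) + B (p t) *v time_deriv T u t) (at t within T)"
          using has_vector_derivative_add [OF v [OF t] product [OF p u assms(6) t]]
          by (simp add: algebra_simps)
        have "((\<lambda>t. w t + D (p t) *v u t) has_vector_derivative
            C (p t) *v (v t + B (p t) *v u t) + D (p t) *v time_deriv T u t) (at t within T)"
          using has_vector_derivative_add [OF w [OF t] product [OF p u assms(7) t]]
          by (simp add: algebra_simps)
        \<comment> \<open>The output equation holds only on \<open>T\<close>, which suffices for a
          derivative relative to \<open>T\<close>. Uniqueness of that derivative then determines
          \<open>time_deriv T y t\<close>.\<close>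
        then have "(y has_vector_derivative
            C (p t) *v (v t + B (p t) *v u t) + D (p t) *v time_deriv T u t) (at t within T)"
          by (rule has_vector_derivative_transform [OF t, rotated]) (simp add: y)
        then show "time_deriv T y t =
            C (p t) *v (v t + B (p t) *v u t) + D (p t) *v time_deriv T u t"
          by (rule time_deriv_eqI [OF assms(1,2) t])
      qed
      then show "\<exists>xv. velocity_controller T A B C D p xv (time_deriv T u) (time_deriv T y)" by blast
    qed
  qed
qed

end
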